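(* There exist an absolute constant $c>0$ and an integer $k_0$ such that for all integers $k\ge k_0$ and $d\ge 1$, the price of explainability $\rho_{k,d}$ of the $k$-centers problem in $\mathbb{R}^d$ satisfies $$\rho_{k,d}\ \ge\ \begin{cases} c\,k^{1-1/d}, & \text{if } d\le \dfrac{\ln k}{\ln\ln k},\\[2mm] c\,\sqrt{d}\cdot\dfrac{k\sqrt{\ln\ln k}}{\ln^{1.5}k}, & \text{otherwise.}\end{cases}$$
   Context: An instance of the $k$-centers problem is a finite set $X\subset\mathbb{R}^d$ of $n\ge k$ points, with $k\ge2$. A $k$-clustering is a partition $\mathcal{C}=(C_1,\dots,C_k)$ of $X$ into $k$ groups together with a representative $\mu(C_i)\in\mathbb{R}^d$ for each group; its cost is $cost(\mathcal{C})=\max_{i}\max_{x\in C_i}\|x-\mu(C_i)\|_2$. A standard decision tree is a binary tree in which each internal node $v$ is associated with a cut $(i_v,\theta_v)$, $i_v\in\{1,\dots,d\}$, $\theta_v\in\mathbb{R}$; the points reaching $v$ with $i_v$-th coordinate $\le\theta_v$ go to one child and those with $i_v$-th coordinate $>\theta_v$ go to the other. A $k$-clustering is explainable if its partition is the one induced on $X$ by the leaves of a standard decision tree with $k$ leaves (representatives may be arbitrary points of $\mathbb{R}^d$). $OPT_{unr}(X)$ is the minimum cost over all $k$-clusterings of $X$, $OPT_{exp}(X)$ is the minimum cost over all explainable $k$-clusterings of $X$. The price of explainability is $\rho_{k,d}=\sup_X OPT_{exp}(X)/OPT_{unr}(X)$, over all instances $X\subset\mathbb{R}^d$ with $OPT_{unr}(X)>0$.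 *)

theory Defs
  imports "HOL-Analysis.Analysis" "HOL-Library.Tree"
begin

(* The dimension d is quantified inside the theorem, so R^d is the carrier
   topspace (Euclidean_space d): functions nat => real vanishing outside {..<d}.
   Coordinates are therefore numbered 0, ..., d - 1. *)

abbreviation Rspace :: "nat \<Rightarrow> (nat \<Rightarrow> real) set" where
  "Rspace d \<equiv> topspace (Euclidean_space d)"

definition edist :: "nat \<Rightarrow> (nat \<Rightarrow> real) \<Rightarrow> (nat \<Rightarrow> real) \<Rightarrow> real" where
  "edist d x y = L2_set (\<lambda>i. x i - y i) {..<d}"

definition kc_instance :: "nat \<Rightarrow> nat \<Rightarrow> (nat \<Rightarrow> real) set \<Rightarrow> bool" where
  "kc_instance k d X \<longleftrightarrow> 2 \<le> k \<and> finite X \<and> X \<subseteq> Rspace d \<and> k \<le> card X"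

(* A clustering consists of a partition P (its k groups are non-empty) and a
   representative \<mu> C for each C in P; values of \<mu> outside P are irrelevant. *)

definition clustering ::
  "nat \<Rightarrow> nat \<Rightarrow> (nat \<Rightarrow> real) set \<Rightarrow> (nat \<Rightarrow> real) set set \<Rightarrow> ((nat \<Rightarrow> real) set \<Rightarrow> nat \<Rightarrow> real) \<Rightarrow> bool"
where
  "clustering k d X P \<mu> \<longleftrightarrow> partition_on X P \<and> card P = k \<and> (\<forall>C\<in>P. \<mu> C \<in> Rspace d)"

definition clustering_cost ::
  "nat \<Rightarrow> (nat \<Rightarrow> real) set set \<Rightarrow> ((nat \<Rightarrow> real) set \<Rightarrow> nat \<Rightarrow> real) \<Rightarrow> real"
where
  "clustering_cost d P \<mu> = (MAX C\<in>P. MAX x\<in>C. edist d x (\<mu> C))"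

(* A decision tree is a binary tree whose internal nodes carry cuts (i, \<theta>);
   leaf_cells T X collects the subsets of X that reach the leaves of T. *)

definition decision_tree :: "nat \<Rightarrow> (nat \<times> real) tree \<Rightarrow> bool" where
  "decision_tree d T \<longleftrightarrow> (\<forall>(i, \<theta>)\<in>set_tree T. i < d)"

fun leaf_cells :: "(nat \<times> real) tree \<Rightarrow> (nat \<Rightarrow> real) set \<Rightarrow> (nat \<Rightarrow> real) set set" where
  "leaf_cells Leaf X = {X}"
| "leaf_cells (Node l (i, \<theta>) r) X =
     leaf_cells l {x \<in> X. x i \<le> \<theta>} \<union> leaf_cells r {x \<in> X. \<theta> < x i}"

(* size1 counts leaves. If P is a partition with card P = k, then every one of the
   k leaves is reached by a point. Allowing unreached leaves would not change the
   optimal cost: since k \<le> card X, such a leaf can be traded for a split of another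
   cell, and splitting does not increase the cost. *)

definition explainable :: "nat \<Rightarrow> nat \<Rightarrow> (nat \<Rightarrow> real) set \<Rightarrow> (nat \<Rightarrow> real) set set \<Rightarrow> bool" where
  "explainable k d X P \<longleftrightarrow> (\<exists>T. decision_tree d T \<and> size1 T = k \<and> P = leaf_cells T X)"

(* For instances, both infima below are over non-empty sets bounded below by 0 and
   are attained: X has finitely many partitions, and for a fixed partition an optimal
   representative of a group is the centre of its minimum enclosing ball. *)

definition OPT_unr :: "nat \<Rightarrow> nat \<Rightarrow> (nat \<Rightarrow> real) set \<Rightarrow> real" where
  "OPT_unr k d X = Inf {clustering_cost d P \<mu> | P \<mu>. clustering k d X P \<mu>}"

definition OPT_exp :: "nat \<Rightarrow> nat \<Rightarrow> (nat \<Rightarrow> real) set \<Rightarrow> real" where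
  "OPT_exp k d X =
     Inf {clustering_cost d P \<mu> | P \<mu>. clustering k d X P \<mu> \<and> explainable k d X P}"

(* Extended-real valued, so that the supremum is meaningful without a boundedness proof. *)

definition price_of_explainability :: "nat \<Rightarrow> nat \<Rightarrow> ereal" where
  "price_of_explainability k d =
     (SUP X\<in>{X. kc_instance k d X \<and> 0 < OPT_unr k d X}. ereal (OPT_exp k d X / OPT_unr k d X))"

end

theory Submission
  imports Defs "HOL-Number_Theory.Cong"
begin

text \<open>
  Take \<open>k\<close> centres at pairwise distance at least \<open>D\<close> and surround each of them by the star of points at
  distance \<open>1/2\<close> along the coordinate axes, so that the unrestricted optimum is at most \<open>1/2\<close>.
  Suppose that for \<open>R \<ge> 2\<close> of the centres every coordinate takes exactly the values \<open>0, \<dots>, R - 1\<close>.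
  Then an axis-parallel cut that separates two of these \<open>R\<close> stars splits one of them. Hence a tree
  with \<open>k\<close> leaves cannot have each leaf inside a single star: each leaf would then be a whole star,
  but the first cut that separates the \<open>R\<close> stars splits one. Some leaf therefore meets two
  stars, and its cost is at least \<open>(D - 1) / 2\<close>.

  The \<open>R\<close> centres form a lattice-like configuration: coordinate \<open>j\<close> of centre \<open>n\<close> is
  \<open>n * b ^ (j mod q) mod R\<close>, where \<open>b\<close> is \<open>k powr (1 / q)\<close> rounded up and \<open>R \<equiv> 1\<close> modulo \<open>b\<close> is close to
  \<open>k\<close>. Two of these centres differ by order \<open>k powr (1 - 1 / q)\<close> in some residue class of coordinates
  modulo \<open>q\<close>, hence are at distance of order \<open>sqrt (d div q) * k powr (1 - 1 / q)\<close>. The remaining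
  \<open>k - R\<close> centres are placed far away. Use \<open>q = d\<close> in small dimension and \<open>q\<close> equal to
  \<open>ln k / ln (ln k)\<close> rounded up, for which \<open>k powr (1 / q) \<le> ln k\<close>, in large dimension.
\<close>

section \<open>Distances and the cost of a clustering\<close>

lemma edist_nonneg: "0 \<le> edist d x y"
  by (simp add: edist_def)

lemma edist_commute: "edist d x y = edist d y x"
  unfolding edist_def L2_set_def by (simp add: power2_commute)

lemma edist_triangle: "edist d x z \<le> edist d x y + edist d y z"
  using L2_set_triangle_ineq[of "\<lambda>i. x i - y i" "\<lambda>i. y i - z i" "{..<d}"]
  by (simp add: edist_def)

lemma coord_le_edist: "j < d \<Longrightarrow> \<bar>x j - y j\<bar> \<le> edist d x y"
  unfolding edist_def L2_set_def
  by (rule real_le_rsqrt) (auto intro: member_le_sum[where f = "\<lambda>i. (x i - y i)\<^sup>2"])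

lemma edist_pos:
  assumes "x \<in> Rspace d" "y \<in> Rspace d" "x \<noteq> y"
  shows "0 < edist d x y"
proof -
  obtain j where j: "x j \<noteq> y j" using assms(3) by blast
  then have "j < d" using assms(1,2) by (metis (mono_tags, lifting) mem_Collect_eq not_less topspace_Euclidean_space)
  then show ?thesis using coord_le_edist[of j d x y] j by linarith
qed

lemma edist_le_clustering_cost:
  assumes "clustering k d X P \<mu>" "finite X" "C \<in> P" "x \<in> C"
  shows "edist d x (\<mu> C) \<le> clustering_cost d P \<mu>"
proof -
  have p: "partition_on X P" using assms(1) by (simp add: clustering_def)
  have P: "finite P" using finite_elements[OF assms(2) p] .
  have C: "finite C" using p assms(2,3) by (metis finite_subset partition_onD1 Union_upper)
  have "edist d x (\<mu> C) \<le> (MAX x\<in>C. edist d x (\<mu> C))"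
    using C assms(4) by (intro Max_ge) auto
  also have "\<dots> \<le> clustering_cost d P \<mu>"
    unfolding clustering_cost_def using P assms(3) by (intro Max_ge) auto
  finally show ?thesis .
qed

lemma clustering_cost_ge:
  assumes "clustering k d X P \<mu>" "finite X" "C \<in> P" "x \<in> C" "y \<in> C"
  shows "edist d x y / 2 \<le> clustering_cost d P \<mu>"
  using edist_le_clustering_cost[OF assms(1-4)] edist_le_clustering_cost[OF assms(1-3,5)]
    edist_triangle[of d x y "\<mu> C"] edist_commute[of d y "\<mu> C"] by linarith

lemma clustering_cost_nonneg:
  assumes "clustering k d X P \<mu>" "finite X" "0 < k"
  shows "0 \<le> clustering_cost d P \<mu>"
proof -
  have "P \<noteq> {}" "{} \<notin> P" using assms(1,3) by (auto simp: clustering_def partition_on_def)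
  then obtain C x where "C \<in> P" "x \<in> C" by (metis ex_in_conv)
  then show ?thesis
    using edist_le_clustering_cost[OF assms(1,2)] edist_nonneg order_trans by blast
qed

section \<open>Decision trees whose leaves are all reached\<close>

lemma leaf_cells_subset: "C \<in> leaf_cells T X \<Longrightarrow> C \<subseteq> X"
  by (induction T X rule: leaf_cells.induct) auto

lemma partition_on_Un:
  assumes P: "partition_on A P" and Q: "partition_on B Q" and AB: "A \<inter> B = {}"
  shows "partition_on (A \<union> B) (P \<union> Q)"
proof (rule partition_onI)
  show "\<Union>(P \<union> Q) = A \<union> B" using partition_onD1[OF P] partition_onD1[OF Q] by simp
  show "{} \<notin> P \<union> Q" using partition_onD3[OF P] partition_onD3[OF Q] by simp
  fix C D assume CD: "C \<in> P \<union> Q" "D \<in> P \<union> Q" "C \<noteq> D"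
  have "disjnt C D" if "C \<in> P" "D \<in> P" using partition_onD2[OF P] that CD(3) by (rule pairwiseD)
  moreover have "disjnt C D" if "C \<in> Q" "D \<in> Q"
    using partition_onD2[OF Q] that CD(3) by (rule pairwiseD)
  moreover have "C' \<inter> D' = {}" if "C' \<in> P" "D' \<in> Q" for C' D'
    using that partition_onD1[OF P] partition_onD1[OF Q] AB by blast
  ultimately show "disjnt C D" using CD(1,2) by (auto simp: disjnt_def)
qed

text \<open>Two distinct points differ in some coordinate, so a cut there leaves both sides
  non-empty, and the \<open>k\<close> leaves can be shared out between the sides by
  induction.\<close>

lemma ex_tree_partition:
  assumes "finite X" "X \<subseteq> Rspace d" "1 \<le> k" "k \<le> card X"
  shows "\<exists>T. decision_tree d T \<and> size1 T = k \<and> partition_on X (leaf_cells T X)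
    \<and> card (leaf_cells T X) = k"
  using assms
proof (induction k arbitrary: X rule: less_induct)
  case (less k)
  show ?case
  proof (cases "k = 1")
    case True
    then have "X \<noteq> {}" using less.prems by auto
    then show ?thesis using True
      by (intro exI[of _ Leaf]) (auto simp: decision_tree_def partition_on_def)
  next
    case False
    then have "2 \<le> k" "2 \<le> card X" using less.prems by auto
    then have "\<not> is_singleton X" "X \<noteq> {}" by (auto simp: is_singleton_altdef)
    then obtain x y where xy: "x \<in> X" "y \<in> X" "x \<noteq> y"
      by (metis is_singletonI' )
    then obtain i where i: "x i \<noteq> y i" by blast
    have "i < d" using i xy less.prems(2)
      by (auto simp: topspace_Euclidean_space subset_iff) (metis not_less)
    \<comment> \<open>At the smaller of the two coordinates, one point satisfies
      \<open>\<le>\<close> and the other lies strictly above.\<close>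
    define \<theta> where "\<theta> = min (x i) (y i)"
    define X1 where "X1 = {x \<in> X. x i \<le> \<theta>}"
    define X2 where "X2 = {x \<in> X. \<theta> < x i}"
    have ne: "X1 \<noteq> {}" "X2 \<noteq> {}"
      using xy i unfolding X1_def X2_def \<theta>_def by (auto simp: min_def split: if_splits; force)+
    have X: "X = X1 \<union> X2" "X1 \<inter> X2 = {}" by (auto simp: X1_def X2_def)
    have fin: "finite X1" "finite X2" using less.prems(1) X by auto
    have cX: "card X = card X1 + card X2" using X fin by (simp add: card_Un_disjoint)
    have pos: "0 < card X1" "0 < card X2" using ne fin by auto
    \<comment> \<open>The left side takes as many leaves as it has points, but leaves at least one
      for the right. In either case of the minimum, \<open>k2\<close> does not exceed the number of
      points on the right.\<close>
    define k1 where "k1 = min (k - 1) (card X1)"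
    define k2 where "k2 = k - k1"
    have k12: "1 \<le> k1" "k1 < k" "k1 \<le> card X1" "1 \<le> k2" "k2 < k" "k2 \<le> card X2" "k1 + k2 = k"
      using \<open>2 \<le> k\<close> less.prems(4) pos cX unfolding k1_def k2_def by auto
    have sub: "X1 \<subseteq> Rspace d" "X2 \<subseteq> Rspace d" using less.prems(2) X by auto
    obtain l where l: "decision_tree d l" "size1 l = k1" "partition_on X1 (leaf_cells l X1)"
      "card (leaf_cells l X1) = k1"
      using less.IH[of k1 X1] k12 fin sub by blast
    obtain r where r: "decision_tree d r" "size1 r = k2" "partition_on X2 (leaf_cells r X2)"
      "card (leaf_cells r X2) = k2"
      using less.IH[of k2 X2] k12 fin sub by blast
    let ?T = "Node l (i, \<theta>) r"
    have cells: "leaf_cells ?T X = leaf_cells l X1 \<union> leaf_cells r X2"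
      by (simp add: X1_def X2_def)
    have "leaf_cells l X1 \<inter> leaf_cells r X2 = {}"
    proof (rule ccontr)
      assume "leaf_cells l X1 \<inter> leaf_cells r X2 \<noteq> {}"
      then obtain C where C: "C \<in> leaf_cells l X1" "C \<in> leaf_cells r X2" by blast
      then have "C \<subseteq> X1 \<inter> X2" using leaf_cells_subset by blast
      then show False using C(1) l(3) X(2) by (auto simp: partition_on_def)
    qed
    moreover have "finite (leaf_cells l X1)" "finite (leaf_cells r X2)"
      using l(3) r(3) fin finite_elements by blast+
    ultimately have "card (leaf_cells ?T X) = k"
      using cells l(4) r(4) k12 by (simp add: card_Un_disjoint)
    moreover have "partition_on X (leaf_cells ?T X)"
      using partition_on_Un[OF l(3) r(3) X(2)] cells X(1) by simp
    moreover have "decision_tree d ?T" "size1 ?T = k"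
      using l r \<open>i < d\<close> k12 by (auto simp: decision_tree_def)
    ultimately show ?thesis by blast
  qed
qed

text \<open>This makes the sets behind \<open>OPT_exp\<close> and \<open>OPT_unr\<close> non-empty,
  as lower bounds on an infimum of reals require.\<close>

lemma ex_explainable_clustering:
  assumes "kc_instance k d X"
  shows "\<exists>P \<mu>. clustering k d X P \<mu> \<and> explainable k d X P"
proof -
  obtain T where "decision_tree d T" "size1 T = k" "partition_on X (leaf_cells T X)"
    "card (leaf_cells T X) = k"
    using ex_tree_partition[of X d k] assms by (auto simp: kc_instance_def)
  then have "clustering k d X (leaf_cells T X) (\<lambda>_ _. 0)" "explainable k d X (leaf_cells T X)"
    by (auto simp: clustering_def explainable_def topspace_Euclidean_space)
  then show ?thesis by blast
qed

section \<open>Bounds on the optima and the trivial bound on the price\<close>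

lemma le_OPT_exp:
  assumes "kc_instance k d X"
    and "\<And>P \<mu>. clustering k d X P \<mu> \<Longrightarrow> explainable k d X P \<Longrightarrow> a \<le> clustering_cost d P \<mu>"
  shows "a \<le> OPT_exp k d X"
  unfolding OPT_exp_def using ex_explainable_clustering[OF assms(1)] assms(2)
  by (intro cInf_greatest) auto

lemma le_OPT_unr:
  assumes "kc_instance k d X"
    and "\<And>P \<mu>. clustering k d X P \<mu> \<Longrightarrow> a \<le> clustering_cost d P \<mu>"
  shows "a \<le> OPT_unr k d X"
  unfolding OPT_unr_def using ex_explainable_clustering[OF assms(1)] assms(2)
  by (intro cInf_greatest) auto

lemma OPT_unr_le:
  assumes "kc_instance k d X" "clustering k d X P \<mu>"
  shows "OPT_unr k d X \<le> clustering_cost d P \<mu>"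
  unfolding OPT_unr_def using assms clustering_cost_nonneg
  by (intro cInf_lower) (auto simp: kc_instance_def intro!: bdd_belowI[of _ 0])

lemma OPT_unr_le_OPT_exp: "kc_instance k d X \<Longrightarrow> OPT_unr k d X \<le> OPT_exp k d X"
  by (rule le_OPT_exp) (auto intro: OPT_unr_le)

text \<open>By pigeonhole some group contains two distinct points. The finitely many distances
  between distinct points have a positive minimum, and half of it bounds every cost uniformly, so
  the infimum stays positive.\<close>

lemma OPT_unr_pos:
  assumes inst: "kc_instance k d X" and "k < card X"
  shows "0 < OPT_unr k d X"
proof -
  have fin: "finite X" and sub: "X \<subseteq> Rspace d" using inst by (auto simp: kc_instance_def)
  define E where "E = (\<lambda>(x, y). edist d x y) ` {(x, y) \<in> X \<times> X. x \<noteq> y}"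
  have "finite {(x, y) \<in> X \<times> X. x \<noteq> y}" using fin by (auto intro: finite_subset[of _ "X \<times> X"])
  then have finE: "finite E" unfolding E_def by blast
  have two: "\<exists>C\<in>P. \<exists>x\<in>C. \<exists>y\<in>C. x \<noteq> y" if "clustering k d X P \<mu>" for P \<mu>
  proof -
    have p: "partition_on X P" "card P = k" using that by (auto simp: clustering_def)
    have "\<forall>x\<in>X. \<exists>C\<in>P. x \<in> C" using p by (auto simp: partition_on_def)
    then obtain f where f: "\<forall>x\<in>X. f x \<in> P \<and> x \<in> f x" by metis
    have "card (f ` X) \<le> k"
      using f p finite_elements[OF fin p(1)] by (metis card_mono image_subsetI)
    then have "\<not> inj_on f X" using \<open>k < card X\<close> card_image by fastforce
    then show ?thesis using f by (metis inj_on_def)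
  qed
  have low: "Min E / 2 \<le> clustering_cost d P \<mu>" if c: "clustering k d X P \<mu>" for P \<mu>
  proof -
    obtain C x y where C: "C \<in> P" "x \<in> C" "y \<in> C" "x \<noteq> y" using two[OF c] by blast
    then have "x \<in> X" "y \<in> X" using c by (auto simp: clustering_def partition_on_def)
    then have "edist d x y \<in> E" using C by (auto simp: E_def)
    then have "Min E \<le> edist d x y" using finE by simp
    then show ?thesis using clustering_cost_ge[OF c fin C(1-3)] by linarith
  qed
  obtain P \<mu> C x y where "clustering k d X P \<mu>" "C \<in> P" "x \<in> C" "y \<in> C" "x \<noteq> y"
    using two ex_explainable_clustering[OF inst] by blast
  then have "(x, y) \<in> {(x, y) \<in> X \<times> X. x \<noteq> y}" by (auto simp: clustering_def partition_on_def)
  then have "E \<noteq> {}" unfolding E_def by blast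
  moreover have "\<forall>e\<in>E. 0 < e" using edist_pos sub unfolding E_def by fastforce
  ultimately have "0 < Min E" using finE by simp
  then show ?thesis using le_OPT_unr[OF inst low] by linarith
qed

lemma price_ge:
  assumes "kc_instance k d X" "0 < OPT_unr k d X" "a \<le> OPT_exp k d X / OPT_unr k d X"
  shows "ereal a \<le> price_of_explainability k d"
  unfolding price_of_explainability_def using assms by (intro SUP_upper2[of X]) auto

text \<open>This covers dimension 1 and the cases where the separation of the centres is too small
  for the star construction. The witness has \<open>k + 1\<close> points so that its unrestricted
  optimum is positive.\<close>

lemma price_ge_1:
  assumes "2 \<le> k" "1 \<le> d"
  shows "ereal 1 \<le> price_of_explainability k d"
proof -
  define X :: "(nat \<Rightarrow> real) set" where "X = (\<lambda>n. (\<lambda>_. 0)(0 := real n)) ` {..k}"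
  have "inj_on (\<lambda>n::nat. (\<lambda>_::nat. 0)(0 := real n)) {..k}"
    by (rule inj_onI) (metis fun_upd_same of_nat_eq_iff)
  then have card: "card X = k + 1" by (simp add: X_def card_image)
  have inst: "kc_instance k d X"
    using card assms by (auto simp: kc_instance_def X_def topspace_Euclidean_space)
  have pos: "0 < OPT_unr k d X" using OPT_unr_pos[OF inst] card by simp
  show ?thesis using price_ge[OF inst pos] OPT_unr_le_OPT_exp[OF inst] pos by simp
qed

section \<open>Stars that no cut separates without splitting one\<close>

text \<open>A tree that splits no member of the family has a root cut that splits none, so by the
  fourth assumption the whole family goes to one child; induction follows it down to a leaf.\<close>

lemma leaf_cells_unsplit:
  assumes "decision_tree d T" "\<forall>A\<in>\<A>. A \<noteq> {}" "\<forall>A\<in>\<A>. A \<subseteq> X"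
    and "\<And>i \<theta>. i < d \<Longrightarrow> \<forall>A\<in>\<A>. A \<subseteq> {x. x i \<le> \<theta>} \<or> A \<subseteq> {x. \<theta> < x i} \<Longrightarrow>
        \<Union>\<A> \<subseteq> {x. x i \<le> \<theta>} \<or> \<Union>\<A> \<subseteq> {x. \<theta> < x i}"
    and "\<forall>A\<in>\<A>. \<exists>C\<in>leaf_cells T X. A \<subseteq> C"
  shows "\<exists>C\<in>leaf_cells T X. \<Union>\<A> \<subseteq> C"
  using assms(1,3,5)
proof (induction T arbitrary: X)
  case Leaf
  then show ?case by auto
next
  case (Node l v r)
  obtain i \<theta> where v: "v = (i, \<theta>)" by force
  let ?L = "{x \<in> X. x i \<le> \<theta>}" and ?R = "{x \<in> X. \<theta> < x i}"
  have i: "i < d" and dt: "decision_tree d l" "decision_tree d r"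
    using Node.prems(1) v by (auto simp: decision_tree_def)
  have cells: "leaf_cells (Node l v r) X = leaf_cells l ?L \<union> leaf_cells r ?R" by (simp add: v)
  have subL: "A \<subseteq> ?L" if "A \<subseteq> C" "C \<in> leaf_cells l ?L" for A C
    using leaf_cells_subset[OF that(2)] that(1) by blast
  have subR: "A \<subseteq> ?R" if "A \<subseteq> C" "C \<in> leaf_cells r ?R" for A C
    using leaf_cells_subset[OF that(2)] that(1) by blast
  have "\<forall>A\<in>\<A>. A \<subseteq> {x. x i \<le> \<theta>} \<or> A \<subseteq> {x. \<theta> < x i}"
  proof
    fix A assume "A \<in> \<A>"
    then obtain C where "C \<in> leaf_cells l ?L \<union> leaf_cells r ?R" "A \<subseteq> C"
      using Node.prems(3) unfolding cells by blast
    then have "A \<subseteq> ?L \<or> A \<subseteq> ?R" using subL[of A C] subR[of A C] by (elim UnE) simp_all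
    then show "A \<subseteq> {x. x i \<le> \<theta>} \<or> A \<subseteq> {x. \<theta> < x i}" by auto
  qed
  from assms(4)[OF i this] consider "\<Union>\<A> \<subseteq> {x. x i \<le> \<theta>}" | "\<Union>\<A> \<subseteq> {x. \<theta> < x i}" by blast
  then show ?case
  proof cases
    case 1
    have "\<exists>C\<in>leaf_cells l ?L. A \<subseteq> C" if A: "A \<in> \<A>" for A
    proof -
      obtain C where C: "C \<in> leaf_cells l ?L \<union> leaf_cells r ?R" "A \<subseteq> C"
        using Node.prems(3) A unfolding cells by blast
      \<comment> \<open>A point of the member is needed to exclude cells of the other child, since
        an empty set would fit into any cell.\<close>
      obtain x where x: "x \<in> A" using assms(2) A by blast
      then have "x i \<le> \<theta>" using 1 A by blast
      then have "C \<notin> leaf_cells r ?R" using subR[OF C(2)] x by fastforce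
      then show ?thesis using C by blast
    qed
    moreover have "\<forall>A\<in>\<A>. A \<subseteq> ?L" using 1 Node.prems(2) by blast
    ultimately have "\<exists>C\<in>leaf_cells l ?L. \<Union>\<A> \<subseteq> C"
      by (intro Node.IH(1)[OF dt(1)] ballI) simp_all
    then show ?thesis unfolding cells by (rule bexE) (rule bexI, assumption, simp)
  next
    case 2
    have "\<exists>C\<in>leaf_cells r ?R. A \<subseteq> C" if A: "A \<in> \<A>" for A
    proof -
      obtain C where C: "C \<in> leaf_cells l ?L \<union> leaf_cells r ?R" "A \<subseteq> C"
        using Node.prems(3) A unfolding cells by blast
      obtain x where x: "x \<in> A" using assms(2) A by blast
      then have "\<theta> < x i" using 2 A by blast
      then have "C \<notin> leaf_cells l ?L" using subL[OF C(2)] x by fastforce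
      then show ?thesis using C by blast
    qed
    moreover have "\<forall>A\<in>\<A>. A \<subseteq> ?R" using 2 Node.prems(2) by blast
    ultimately have "\<exists>C\<in>leaf_cells r ?R. \<Union>\<A> \<subseteq> C"
      by (intro Node.IH(2)[OF dt(2)] ballI) simp_all
    then show ?thesis unfolding cells by (rule bexE) (rule bexI, assumption, simp)
  qed
qed

text \<open>With radius 1/2, stars whose centres differ by 1 in a coordinate just touch in that
  coordinate, so no cut passes between them.\<close>

definition star :: "nat \<Rightarrow> (nat \<Rightarrow> real) \<Rightarrow> (nat \<Rightarrow> real) set" where
  "star d c = (\<lambda>(j, s). c(j := c j + s)) ` ({..<d} \<times> {-1/2, 1/2})"

lemma edist_star:
  assumes "x \<in> star d c"
  shows "edist d x c = 1 / 2"
proof -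
  obtain j s where js: "j < d" "s \<in> {-1/2, 1/2 :: real}" "x = c(j := c j + s)"
  proof -
    obtain p where "p \<in> {..<d} \<times> {-1/2, 1/2 :: real}" "x = (case p of (j, s) \<Rightarrow> c(j := c j + s))"
      using assms unfolding star_def by (rule imageE)
    then show thesis using that[of "fst p" "snd p"] by (simp add: case_prod_unfold mem_Times_iff)
  qed
  have "(\<Sum>i<d. (x i - c i)\<^sup>2) = (\<Sum>i<d. if i = j then s\<^sup>2 else 0)"
    using js(3) by (intro sum.cong) auto
  also have "\<dots> = s\<^sup>2" using js(1) by simp
  also have "\<dots> = (1/2)\<^sup>2"
    using js(2) by (elim insertE emptyE; hypsubst; simp add: power2_eq_square)
  finally have "edist d x c = sqrt ((1/2)\<^sup>2)" by (simp only: edist_def L2_set_def)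
  then show ?thesis by simp
qed

lemma star_subset_Rspace: "c \<in> Rspace d \<Longrightarrow> star d c \<subseteq> Rspace d"
  by (auto simp: star_def topspace_Euclidean_space)

lemma finite_star: "finite (star d c)"
  by (simp add: star_def)

lemma star_plus: "j < d \<Longrightarrow> c(j := c j + 1/2) \<in> star d c"
  and star_minus: "j < d \<Longrightarrow> c(j := c j - 1/2) \<in> star d c"
  unfolding star_def by force+

text \<open>Points of different stars are at distance at least \<open>D - 1\<close>, so a group
  meeting two stars costs at least \<open>(D - 1) / 2\<close>, against at most 1/2 for the
  clustering into stars. Only the first \<open>R\<close> centres need the integer projections; the
  others just fill up the number of groups.\<close>

lemma price_ge_separation:
  fixes c :: "nat \<Rightarrow> nat \<Rightarrow> real"
  assumes k: "2 \<le> k" and d: "1 \<le> d" and cR: "\<And>n. n < k \<Longrightarrow> c n \<in> Rspace d"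
    and D: "2 < D" and sep: "\<And>m n. m < n \<Longrightarrow> n < k \<Longrightarrow> D \<le> edist d (c m) (c n)"
    and R: "2 \<le> R" "R \<le> k"
    and proj: "\<And>j. j < d \<Longrightarrow> (\<lambda>n. c n j) ` {..<R} = real ` {..<R}"
  shows "ereal (D - 1) \<le> price_of_explainability k d"
proof -
  define B where "B n = star d (c n)" for n
  define X where "X = (\<Union>n<k. B n)"
  have Bne: "B n \<noteq> {}" for n using star_plus[of 0 d "c n"] d by (auto simp: B_def)
  have far: "D - 1 \<le> edist d x y" if "m < k" "n < k" "m \<noteq> n" "x \<in> B m" "y \<in> B n" for m n x y
  proof -
    have "D \<le> edist d (c m) (c n)"
      using sep[of m n] sep[of n m] that(1-3) edist_commute[of d "c m" "c n"] by fastforce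
    then show ?thesis
      using edist_triangle[of d "c m" "c n" x] edist_triangle[of d x "c n" y]
        edist_star[of x d "c m"] edist_star[of y d "c n"] that(4,5) edist_commute[of d x "c m"]
      unfolding B_def by linarith
  qed
  have uniq: "m = n" if "m < k" "n < k" "x \<in> B m" "x \<in> B n" for m n x
  proof (rule ccontr)
    assume "m \<noteq> n"
    then have "D - 1 \<le> edist d x x" using far that by blast
    then show False using D by (simp add: edist_def L2_set_def)
  qed
  have injB: "inj_on B {..<k}"
    using uniq Bne unfolding inj_on_def by (metis all_not_in_conv lessThan_iff)
  have finX: "finite X" by (auto simp: X_def B_def finite_star)
  have XR: "X \<subseteq> Rspace d"
    using cR star_subset_Rspace by (fastforce simp: X_def B_def)
  have cardX: "k < card X"
  proof -
    have "2 \<le> card (B n)" for n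
    proof -
      have "(c n)(0 := c n 0 + 1/2) \<noteq> (c n)(0 := c n 0 - 1/2)" by (simp add: fun_eq_iff)
      then have "card {(c n)(0 := c n 0 + 1/2), (c n)(0 := c n 0 - 1/2)} = 2" by simp
      moreover have "{(c n)(0 := c n 0 + 1/2), (c n)(0 := c n 0 - 1/2)} \<subseteq> B n"
        using star_plus[of 0 d] star_minus[of 0 d] d by (simp add: B_def)
      ultimately show ?thesis by (metis B_def card_mono finite_star)
    qed
    then have "(\<Sum>n<k. 2) \<le> (\<Sum>n<k. card (B n))" by (intro sum_mono) auto
    also have "\<dots> = card X" unfolding X_def
      using uniq by (intro card_UN_disjoint[symmetric]) (auto simp: B_def finite_star)
    finally show ?thesis using k by simp
  qed
  have inst: "kc_instance k d X" using k finX XR cardX by (simp add: kc_instance_def)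
  have pos: "0 < OPT_unr k d X" by (rule OPT_unr_pos[OF inst cardX])
  have unr: "OPT_unr k d X \<le> 1/2"
  proof -
    \<comment> \<open>Representatives are indexed by sets, so the centre of a star is recovered by
      inverting \<open>B\<close>.\<close>
    define \<mu> where "\<mu> C = c (the_inv_into {..<k} B C)" for C
    have \<mu>: "\<mu> (B n) = c n" if "n < k" for n
      using that injB by (simp add: \<mu>_def the_inv_into_f_f)
    have "partition_on X (B ` {..<k})"
    proof (rule partition_onI)
      fix C C' assume "C \<in> B ` {..<k}" "C' \<in> B ` {..<k}" "C \<noteq> C'"
      then show "disjnt C C'" using uniq by (fastforce simp: disjnt_iff)
    qed (use Bne in \<open>auto simp: X_def\<close>)
    then have cl: "clustering k d X (B ` {..<k}) \<mu>"
      using \<mu> cR injB by (auto simp: clustering_def card_image)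
    have "clustering_cost d (B ` {..<k}) \<mu> \<le> 1/2"
    proof -
      have "(MAX x\<in>B n. edist d x (\<mu> (B n))) \<le> 1/2" if "n < k" for n
        using Bne[of n] \<mu>[OF that]
        by (subst Max_le_iff) (auto simp: B_def finite_star edist_star)
      then show ?thesis
        unfolding clustering_cost_def using k
        by (subst Max_le_iff) (auto simp: lessThan_empty_iff)
    qed
    then show ?thesis using OPT_unr_le[OF inst cl] by linarith
  qed
  have uncut: "\<Union>(B ` {..<R}) \<subseteq> {x. x i \<le> \<theta>} \<or> \<Union>(B ` {..<R}) \<subseteq> {x. \<theta> < x i}"
    if i: "i < d" and side: "\<forall>A\<in>B ` {..<R}. A \<subseteq> {x. x i \<le> \<theta>} \<or> A \<subseteq> {x. \<theta> < x i}" for i \<theta>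
  proof (rule ccontr)
    assume "\<not> ?thesis"
    then obtain m n where "m < R" "n < R" "\<not> B m \<subseteq> {x. \<theta> < x i}" "\<not> B n \<subseteq> {x. x i \<le> \<theta>}"
      unfolding UN_subset_iff by blast
    then have mn: "m < R" "n < R" "B m \<subseteq> {x. x i \<le> \<theta>}" "B n \<subseteq> {x. \<theta> < x i}"
      using side by blast+
    have le: "c a i + 1/2 \<le> \<theta>" if "B a \<subseteq> {x. x i \<le> \<theta>}" for a
      using star_plus[OF i, of "c a"] that unfolding B_def by force
    have gt: "\<theta> < c a i - 1/2" if "B a \<subseteq> {x. \<theta> < x i}" for a
      using star_minus[OF i, of "c a"] that unfolding B_def by force
    \<comment> \<open>Discrete walk along coordinate \<open>i\<close>: if the star at value
      \<open>v\<close> is on the left, then \<open>v + 1/2 \<le> \<theta>\<close>. A star at value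
      \<open>v + 1\<close> exists by \<open>proj\<close> and, being unsplit, cannot be on the right,
      so it is on the left too.\<close>
    have step: "real v + 1/2 \<le> \<theta>" if "v < R" "v \<ge> v0" "real v0 + 1/2 \<le> \<theta>" for v v0
      using that(2,1)
    proof (induction v rule: dec_induct)
      case base
      then show ?case using that by simp
    next
      case (step v)
      have "real (Suc v) \<in> (\<lambda>n. c n i) ` {..<R}" using proj[OF i] step.prems by blast
      then obtain a where a: "a < R" "c a i = real (Suc v)" by auto
      have "\<not> \<theta> < real (Suc v) - 1/2" using step by simp
      then have "B a \<subseteq> {x. x i \<le> \<theta>}" using gt[of a] a side by auto
      then show ?case using le a by metis
    qed
    have "c m i \<in> real ` {..<R}" "c n i \<in> real ` {..<R}"
      unfolding proj[OF i, symmetric] using mn(1,2) by blast+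
    then obtain u v where uv: "u < R" "v < R" "c m i = real u" "c n i = real v" by blast
    have "real u + 1/2 \<le> \<theta>" "\<theta> < real v - 1/2" using le[OF mn(3)] gt[OF mn(4)] uv by simp_all
    then show False using step[of v u] uv by (cases "u \<le> v") auto
  qed
  have "(D - 1) / 2 \<le> clustering_cost d P \<mu>"
    if cl: "clustering k d X P \<mu>" and ex: "explainable k d X P" for P \<mu>
  proof (rule ccontr)
    assume less: "\<not> ?thesis"
    have p: "partition_on X P" "card P = k" using cl by (auto simp: clustering_def)
    have finP: "finite P" using finite_elements[OF finX p(1)] .
    have pure: "m = n" if "C \<in> P" "x \<in> C" "y \<in> C" "m < k" "n < k" "x \<in> B m" "y \<in> B n" for C x y m n
      using far[of m n x y] clustering_cost_ge[OF cl finX that(1-3)] less that by fastforce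
    have "\<forall>n<k. \<exists>C\<in>P. C \<inter> B n \<noteq> {}"
      using Bne p(1) unfolding partition_on_def X_def by fast
    then obtain f where f: "\<forall>n<k. f n \<in> P \<and> f n \<inter> B n \<noteq> {}" by metis
    \<comment> \<open>The \<open>k\<close> stars select \<open>k\<close> different groups, hence all
      of them. So every point of a star must lie in the group selected by that star, and each star
      is contained in one leaf.\<close>
    have "inj_on f {..<k}"
    proof (rule inj_onI)
      fix m n assume mn: "m \<in> {..<k}" "n \<in> {..<k}" "f m = f n"
      then have "f m \<in> P" "f m \<inter> B m \<noteq> {}" "f n \<inter> B n \<noteq> {}" using f by blast+
      then obtain x y where "x \<in> f m" "x \<in> B m" "y \<in> f m" "y \<in> B n"
        unfolding mn(3)[symmetric] by blast
      then show "m = n" using pure[OF \<open>f m \<in> P\<close>, of x y m n] mn(1,2) by simp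
    qed
    then have fP: "f ` {..<k} = P"
      using f p(2) finP by (intro card_subset_eq) (auto simp: card_image)
    have Bf: "B n \<subseteq> f n" if n: "n < k" for n
    proof
      fix x assume x: "x \<in> B n"
      then have "x \<in> X" using n by (auto simp: X_def)
      then have "x \<in> \<Union> (f ` {..<k})" unfolding fP using partition_onD1[OF p(1)] by simp
      then obtain m where m: "m < k" "x \<in> f m" by blast
      then have "f m \<in> P" "f m \<inter> B m \<noteq> {}" using f by blast+
      then obtain y where "y \<in> f m" "y \<in> B m" by blast
      then have "m = n" using pure[OF \<open>f m \<in> P\<close> _ m(2) m(1) n _ x] by blast
      then show "x \<in> f n" using m by simp
    qed
    obtain T where T: "decision_tree d T" "P = leaf_cells T X"
      using ex by (auto simp: explainable_def)
    have "\<exists>C\<in>leaf_cells T X. \<Union>(B ` {..<R}) \<subseteq> C"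
    proof (rule leaf_cells_unsplit[OF T(1) _ _ uncut])
      show "\<forall>A\<in>B ` {..<R}. A \<noteq> {}" using Bne by blast
      show "\<forall>A\<in>B ` {..<R}. A \<subseteq> X"
      proof
        fix A assume "A \<in> B ` {..<R}"
        then obtain n where "n < R" "A = B n" by blast
        then show "A \<subseteq> X" using R(2) by (auto simp: X_def intro!: UN_upper)
      qed
      show "\<forall>A\<in>B ` {..<R}. \<exists>C\<in>leaf_cells T X. A \<subseteq> C"
      proof
        fix A assume "A \<in> B ` {..<R}"
        then obtain n where n: "n < R" "A = B n" by blast
        then have "n < k" using R(2) by simp
        then have "f n \<in> leaf_cells T X" "A \<subseteq> f n" using f Bf n(2) T(2) by blast+
        then show "\<exists>C\<in>leaf_cells T X. A \<subseteq> C" by blast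
      qed
    qed auto
    then obtain C where C: "C \<in> P" "\<Union>(B ` {..<R}) \<subseteq> C" using T(2) by blast
    obtain x y where xy: "x \<in> B 0" "y \<in> B 1" using Bne by blast
    moreover have "0 \<in> {..<R}" "1 \<in> {..<R}" using R by auto
    ultimately have "x \<in> C" "y \<in> C" using C(2) by blast+
    then show False using pure[OF C(1) _ _ _ _ xy] k by simp
  qed
  then have "(D - 1) / 2 \<le> OPT_exp k d X" by (rule le_OPT_exp[OF inst])
  moreover have "(D - 1) * OPT_unr k d X \<le> (D - 1) * (1/2)"
    using unr D by (intro mult_left_mono) auto
  ultimately have "D - 1 \<le> OPT_exp k d X / OPT_unr k d X"
    using pos by (simp add: le_divide_eq)
  then show ?thesis by (rule price_ge[OF inst pos])
qed

section \<open>Well-separated centres with integer projections\<close>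

text \<open>
  If all differences \<open>\<Delta> l\<close> of residues were below \<open>L\<close>, the congruence of \<open>\<Delta> (Suc l)\<close> and \<open>b * \<Delta> l\<close>
  modulo \<open>R\<close> would be an equality, so the differences would grow geometrically beyond \<open>L\<close>.
\<close>

lemma geometric_residues_separated:
  fixes b q R :: nat and L :: real
  assumes mn: "m < R" "n < R" "m \<noteq> n" and L: "L \<le> real b ^ (q - 1)" "(real b + 1) * L \<le> real R"
    and q: "1 \<le> q"
  shows "\<exists>l<q. L \<le> \<bar>real (m * b ^ l mod R) - real (n * b ^ l mod R)\<bar>"
proof (rule ccontr)
  assume "\<not> ?thesis"
  then have small: "\<bar>real (m * b ^ l mod R) - real (n * b ^ l mod R)\<bar> < L" if "l < q" for l
    using that by (auto simp: not_le)
  define \<Delta> where "\<Delta> l = int (m * b ^ l mod R) - int (n * b ^ l mod R)" for l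
  have sm: "real_of_int \<bar>\<Delta> l\<bar> < L" if "l < q" for l
    using small[OF that] by (simp add: \<Delta>_def)
  have "\<Delta> l = int b ^ l * \<Delta> 0" if "l < q" for l
    using that
  proof (induction l)
    case (Suc l)
    have "[int (n * b ^ Suc l mod R) = int b * int (n * b ^ l mod R)] (mod int R)" for n
      by (simp add: cong_def zmod_int mod_mult_right_eq mult_ac)
    then have "[\<Delta> (Suc l) = int b * int (m * b ^ l mod R) - int b * int (n * b ^ l mod R)] (mod int R)"
      unfolding \<Delta>_def by (intro cong_diff)
    then have dvd: "int R dvd \<Delta> (Suc l) - int b * \<Delta> l"
      by (simp add: cong_iff_dvd_diff \<Delta>_def algebra_simps)
    \<comment> \<open>The difference is a multiple of \<open>R\<close> of absolute value below
      \<open>L + b * L \<le> R\<close>, hence zero.\<close>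
    have "real_of_int \<bar>\<Delta> (Suc l) - int b * \<Delta> l\<bar> \<le> real_of_int \<bar>\<Delta> (Suc l)\<bar> + real b * real_of_int \<bar>\<Delta> l\<bar>"
      using abs_triangle_ineq4[of "real_of_int (\<Delta> (Suc l))" "real b * real_of_int (\<Delta> l)"]
      by (simp add: abs_mult)
    also have "\<dots> < L + real b * L"
      using sm[of "Suc l"] sm[of l] Suc.prems by (intro add_less_le_mono mult_left_mono) auto
    also have "\<dots> \<le> real R" using L(2) by (simp add: algebra_simps)
    finally have "\<bar>\<Delta> (Suc l) - int b * \<Delta> l\<bar> < int R" by linarith
    then have "\<Delta> (Suc l) - int b * \<Delta> l = 0" using dvd_imp_le_int[OF _ dvd] by linarith
    then show ?case using Suc by simp
  qed simp
  from this[of "q - 1"] have eq: "\<Delta> (q - 1) = int b ^ (q - 1) * \<Delta> 0" using q by simp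
  \<comment> \<open>At exponent 0 the residues are \<open>m\<close> and \<open>n\<close> themselves,
    because both are below \<open>R\<close>.\<close>
  have "\<Delta> 0 \<noteq> 0" using mn by (simp add: \<Delta>_def)
  then have "1 \<le> real_of_int \<bar>\<Delta> 0\<bar>" by simp
  then have "real b ^ (q - 1) * 1 \<le> real b ^ (q - 1) * real_of_int \<bar>\<Delta> 0\<bar>"
    by (intro mult_left_mono) auto
  also have "\<dots> = real_of_int \<bar>\<Delta> (q - 1)\<bar>" unfolding eq by (simp add: abs_mult)
  also have "\<dots> < L" using sm[of "q - 1"] q by simp
  finally show False using L(1) by simp
qed

text \<open>Multiplication by a unit permutes the residues; this yields the full integer projections
  of the centres.\<close>

lemma residues_image:
  fixes a R :: nat
  assumes "coprime a R" "0 < R"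
  shows "(\<lambda>n. n * a mod R) ` {..<R} = {..<R}"
proof (rule endo_inj_surj)
  show "inj_on (\<lambda>n. n * a mod R) {..<R}"
  proof (rule inj_onI)
    fix m n assume "m \<in> {..<R}" "n \<in> {..<R}" "m * a mod R = n * a mod R"
    then show "m = n"
      using cong_mult_rcancel_nat[OF assms(1), of m n] cong_less_modulus_unique_nat[of m n R]
      by (simp add: cong_def)
  qed
qed (use assms in auto)

text \<open>Each residue class modulo \<open>q\<close> contains at least \<open>d div q\<close>
  coordinates, all with the same entry, so a gap \<open>L\<close> in one class gives distance
  \<open>D\<close>. The division by 2 comes from \<open>D / 2 \<le> D - 1\<close> for
  \<open>D > 2\<close>, while for \<open>D \<le> 2\<close> the trivial price 1 suffices.\<close>

lemma price_ge_lattice: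
  fixes b q R k d :: nat and L :: real
  assumes k: "2 \<le> k" and q: "1 \<le> q" "q \<le> d" and R: "2 \<le> R" "R \<le> k" "coprime b R"
    and L: "0 \<le> L" "L \<le> real b ^ (q - 1)" "(real b + 1) * L \<le> real R"
  shows "ereal (sqrt (real (d div q)) * L / 2) \<le> price_of_explainability k d"
proof -
  define D where "D = sqrt (real (d div q)) * L"
  have d: "1 \<le> d" using q by simp
  show ?thesis
  proof (cases "D \<le> 2")
    case True
    then have "ereal (D / 2) \<le> ereal 1" by simp
    then show ?thesis using price_ge_1[OF k d] unfolding D_def by (rule order_trans)
  next
    case False
    define c where "c n j = (if d \<le> j then 0 else if n < R then real (n * b ^ (j mod q) mod R)
       else real (n + 1) * D)" for n j
    have sep: "D \<le> edist d (c m) (c n)" if mn: "m < n" "n < k" for m n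
    proof (cases "n < R")
      case True
      then obtain l where l: "l < q"
        "L \<le> \<bar>real (m * b ^ l mod R) - real (n * b ^ l mod R)\<bar>"
        using geometric_residues_separated[of m R n L b q] mn L q by auto
      let ?J = "(\<lambda>s. l + q * s) ` {..<d div q}"
      have J: "?J \<subseteq> {..<d}"
      proof
        fix j assume "j \<in> ?J"
        then obtain s where s: "s < d div q" "j = l + q * s" by blast
        then have "q * Suc s \<le> q * (d div q)" by (intro mult_le_mono2) simp
        also have "\<dots> \<le> d" by simp
        finally show "j \<in> {..<d}" using s l(1) by simp
      qed
      have "real (d div q) * L\<^sup>2 = (\<Sum>j\<in>?J. L\<^sup>2)"
        using q by (simp add: card_image inj_on_def)
      also have "\<dots> \<le> (\<Sum>j\<in>?J. (c m j - c n j)\<^sup>2)"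
      proof (rule sum_mono)
        fix j assume j: "j \<in> ?J"
        then have "j mod q = l" using l(1) by auto
        moreover have "j < d" using j J by blast
        ultimately have "L \<le> \<bar>c m j - c n j\<bar>" using l True mn by (simp add: c_def)
        then show "L\<^sup>2 \<le> (c m j - c n j)\<^sup>2" using L(1) by (metis power2_abs power_mono)
      qed
      also have "\<dots> \<le> (\<Sum>j<d. (c m j - c n j)\<^sup>2)" using J by (intro sum_mono2) auto
      finally have "sqrt (real (d div q) * L\<^sup>2) \<le> edist d (c m) (c n)"
        by (simp add: edist_def L2_set_def)
      then show ?thesis using L(1) by (simp add: D_def real_sqrt_mult)
    next
      case nR: False
      have "D \<le> \<bar>c m 0 - c n 0\<bar>"
      proof (cases "m < R")
        case True
        \<comment> \<open>Entries of the first \<open>R\<close> centres are at most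
          \<open>R \<le> n \<le> n * D\<close>, which is \<open>D\<close> below the entry
          \<open>(n + 1) * D\<close> of a remaining centre.\<close>
        have "c m 0 \<le> real R" using True d by (simp add: c_def order_less_imp_le)
        also have "\<dots> \<le> real n * 1" using nR by simp
        also have "\<dots> \<le> real n * D" using False by (intro mult_left_mono) auto
        finally have "D \<le> c n 0 - c m 0" using nR d by (simp add: c_def algebra_simps)
        then show ?thesis by linarith
      next
        case mR: False
        have "(real m + 1) * D \<le> real n * D" using False mn by (intro mult_right_mono) auto
        then have "D \<le> c n 0 - c m 0" using nR mR d by (simp add: c_def algebra_simps)
        then show ?thesis by linarith
      qed
      then show ?thesis using coord_le_edist[of 0 d "c m" "c n"] d by linarith
    qed
    have proj: "(\<lambda>n. c n j) ` {..<R} = real ` {..<R}" if "j < d" for j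
    proof -
      have "(\<lambda>n. c n j) ` {..<R} = real ` (\<lambda>n. n * b ^ (j mod q) mod R) ` {..<R}"
        unfolding image_image using that by (intro image_cong) (auto simp: c_def)
      then show ?thesis using residues_image[of "b ^ (j mod q)" R] R by simp
    qed
    have "ereal (D - 1) \<le> price_of_explainability k d"
    proof (rule price_ge_separation[of k d c D R])
      show "c n \<in> Rspace d" for n by (simp add: c_def topspace_Euclidean_space)
    qed (use k d False sep R proj in auto)
    moreover have "ereal (D / 2) \<le> ereal (D - 1)" using False by simp
    ultimately show ?thesis unfolding D_def[symmetric] by (meson order_trans)
  qed
qed

section \<open>Choice of the parameters\<close>

lemma price_ge_powr:
  fixes k q d :: nat
  assumes k: "8 \<le> k" and q: "2 \<le> q" "q \<le> d"
  shows "ereal (sqrt (real (d div q)) * real k powr (1 - 1 / real q) / 12)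
    \<le> price_of_explainability k d"
proof -
  define t where "t = real k powr (1 / real q)"
  define b where "b = nat \<lceil>t\<rceil>"
  \<comment> \<open>The largest number up to \<open>k\<close> that is 1 modulo \<open>b\<close>: it
    is coprime to \<open>b\<close> and less than \<open>b\<close> below \<open>k\<close>.\<close>
  define R where "R = b * ((k - 1) div b) + 1"
  \<comment> \<open>The factor 1/6 comes from \<open>b + 1 \<le> 3 * t\<close> and
    \<open>R \<ge> k / 2\<close>: then \<open>(b + 1) * L \<le> k / 2 \<le> R\<close>.\<close>
  define L where "L = real k powr (1 - 1 / real q) / 6"
  have t1: "1 \<le> t" unfolding t_def using k q by (intro ge_one_powr_ge_zero) auto
  have tb: "t \<le> real b" "real b < t + 1" unfolding b_def using t1 by linarith+
  have tk: "t * real k powr (1 - 1 / real q) = real k"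
    unfolding t_def using k by (simp flip: powr_add)
  \<comment> \<open>Here \<open>q \<ge> 2\<close> enters. Together with \<open>k \<ge> 8\<close> it
    gives \<open>b \<le> sqrt k + 1 \<le> k / 2\<close>, so \<open>R\<close> keeps at least half of
    \<open>k\<close>.\<close>
  have "t \<le> real k powr (1/2)" unfolding t_def using k q by (intro powr_mono) (auto simp: field_simps)
  then have t2: "t \<le> sqrt (real k)" using k by (simp add: powr_half_sqrt)
  have "real k / 2 - 1 \<ge> sqrt (real k)"
  proof (rule real_le_lsqrt)
    have "0 \<le> real k * (real k - 8)" using k by simp
    then show "real k \<le> (real k / 2 - 1)\<^sup>2" by (simp add: power2_eq_square algebra_simps)
  qed (use k in auto)
  then have b2: "real b \<le> real k / 2" using t2 tb by linarith
  have b0: "0 < b" using tb t1 by linarith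
  have "(k - 1) mod b + b * ((k - 1) div b) = k - 1" by simp
  moreover have "(k - 1) mod b < b" using b0 by simp
  ultimately have Rk: "R \<le> k" "k \<le> R + b" using k unfolding R_def by linarith+
  then have R2: "real k / 2 \<le> real R" using b2 by linarith
  have "coprime b R" unfolding R_def by (rule coprimeI) (metis dvd_add_right_iff dvd_mult2)
  moreover have "real k powr (1 - 1 / real q) = t ^ (q - 1)"
  proof -
    have "t ^ (q - 1) = real k powr (1 / real q * real (q - 1))"
      unfolding t_def using k by (simp add: powr_powr flip: powr_realpow)
    also have "1 / real q * real (q - 1) = 1 - 1 / real q" using q by (simp add: field_simps of_nat_diff)
    finally show ?thesis by simp
  qed
  then have "6 * L \<le> real b ^ (q - 1)" using tb t1 unfolding L_def by (simp add: power_mono)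
  moreover have L0: "0 \<le> L" by (simp add: L_def)
  moreover have "(real b + 1) * L \<le> real R"
  proof -
    have "(real b + 1) * L \<le> (3 * t) * L" using tb t1 L0 by (intro mult_right_mono) auto
    also have "\<dots> = real k / 2" using tk by (simp add: L_def)
    finally show ?thesis using R2 by linarith
  qed
  ultimately have "ereal (sqrt (real (d div q)) * L / 2) \<le> price_of_explainability k d"
    using k q Rk R2 by (intro price_ge_lattice[of k q d R b L]) auto
  then show ?thesis by (simp add: L_def)
qed

theorem theorem1:
  shows "\<exists>c::real. 0 < c \<and> (\<exists>k0::nat. \<forall>k d::nat. k0 \<le> k \<longrightarrow> 1 \<le> d \<longrightarrow>
    price_of_explainability k d \<ge> ereal
      (if real d \<le> ln (real k) / ln (ln (real k))
       then c * real k powr (1 - 1 / real d)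
       else c * sqrt (real d) * (real k * sqrt (ln (ln (real k))) / ln (real k) powr 1.5)))"
proof -
  have "ereal (if real d \<le> ln (real k) / ln (ln (real k))
       then 1/24 * real k powr (1 - 1 / real d)
       else 1/24 * sqrt (real d) * (real k * sqrt (ln (ln (real k))) / ln (real k) powr 1.5))
       \<le> price_of_explainability k d" if k: "8 \<le> k" and d: "1 \<le> d" for k d :: nat
  proof (cases "real d \<le> ln (real k) / ln (ln (real k))")
    case True
    have "ereal (1/24 * real k powr (1 - 1 / real d)) \<le> price_of_explainability k d"
    proof (cases "d = 1")
      case True
      \<comment> \<open>In dimension 1 the exponent vanishes and the claimed bound is the constant
        1/24.\<close>
      then have "ereal (1/24 * real k powr (1 - 1 / real d)) \<le> ereal 1" using k by simp
      also have "\<dots> \<le> price_of_explainability k d" using price_ge_1 k d by auto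
      finally show ?thesis .
    next
      case False
      then have "ereal (1/24 * real k powr (1 - 1 / real d))
          \<le> ereal (sqrt (real (d div d)) * real k powr (1 - 1 / real d) / 12)" using d by simp
      also have "\<dots> \<le> price_of_explainability k d" using price_ge_powr[of k d d] k d False by simp
      finally show ?thesis .
    qed
    then show ?thesis using True by simp
  next
    case False
    define x where "x = ln (real k)"
    define y where "y = ln x"
    have "exp 1 < real k" using k exp_le by linarith
    then have x1: "1 < x" unfolding x_def using k ln_less_cancel_iff[of "exp 1" "real k"] by simp
    have y0: "0 < y" "y < x" unfolding y_def using x1 ln_less_self by auto
    define q where "q = nat \<lceil>x / y\<rceil>"
    have xy: "1 < x / y" using y0 by simp
    have q: "x / y \<le> real q" "real q < x / y + 1" unfolding q_def using xy by linarith+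
    have q2: "2 \<le> q" using q(1) xy by linarith
    \<comment> \<open>In this case \<open>d\<close> is an integer above \<open>x / y\<close>, so it
      is at least the ceiling.\<close>
    have dq: "q \<le> d" using False unfolding q_def x_def[symmetric] y_def[symmetric] by linarith
    have kx: "real k = exp x" unfolding x_def using k by simp
    have "x / real q \<le> y" using q(1) y0 q2 by (simp add: field_simps)
    then have "real k powr (1 - 1 / real q) \<ge> exp (x - y)"
      using k by (simp add: powr_def algebra_simps x_def[symmetric])
    moreover have "exp (x - y) = real k / x" using x1 by (simp add: exp_diff kx y_def)
    ultimately have p: "real k / x \<le> real k powr (1 - 1 / real q)" by simp
    \<comment> \<open>Rounding down \<open>d / q\<close> loses at most a factor 2, and so does
      rounding up \<open>x / y\<close>; together they give the 4 in the bound on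
      \<open>d div q\<close>.\<close>
    have "d < q * (d div q + 1)" using q2 dividend_less_times_div[of q d] by simp
    also have "\<dots> \<le> q * (2 * (d div q))"
    proof -
      have "1 \<le> d div q" using dq q2 by (simp add: div_greater_zero_iff Suc_le_eq)
      then show ?thesis by (intro mult_le_mono2) simp
    qed
    finally have "real d \<le> real q * (2 * real (d div q))"
      by (metis of_nat_mult of_nat_numeral of_nat_mono less_imp_le)
    also have "\<dots> \<le> (2 * (x / y)) * (2 * real (d div q))"
      using q(2) xy by (intro mult_right_mono) auto
    finally have "real d * y / (4 * x) \<le> real (d div q)"
      using x1 y0 by (simp add: field_simps)
    then have m: "sqrt (real d * y / (4 * x)) \<le> sqrt (real (d div q))" by simp
    \<comment> \<open>The square root of that 4 turns 1/12 into the final constant 1/24.\<close>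
    have "x powr 1.5 = x * sqrt x"
      using x1 powr_add[of x 1 "1/2"] by (simp add: powr_half_sqrt)
    then have "1/24 * sqrt (real d) * (real k * sqrt y / x powr 1.5)
        = sqrt (real d * y / (4 * x)) * (real k / x) / 12"
      by (simp add: real_sqrt_divide real_sqrt_mult mult_ac)
    also have "\<dots> \<le> sqrt (real (d div q)) * real k powr (1 - 1 / real q) / 12"
      using m p x1 by (intro divide_right_mono mult_mono) auto
    finally have "ereal (1/24 * sqrt (real d) * (real k * sqrt y / x powr 1.5))
        \<le> ereal (sqrt (real (d div q)) * real k powr (1 - 1 / real q) / 12)" by simp
    also have "\<dots> \<le> price_of_explainability k d" by (rule price_ge_powr[OF k q2 dq])
    finally show ?thesis using False by (simp add: x_def y_def)
  qed
  then show ?thesis by (intro exI[of _ "1/24"] exI[of _ 8] conjI) auto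
qed

end
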